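(* Let $A$ be a $C^*$-algebra, and let $a, b\in A$ be regular elements such that $ab$ is also regular. Define $p = bb^{\dagger}$, $q = a^{\dagger}(a^{\dagger})^{*}$, $r = bb^*$ and $s = a^{\dagger}a$. Then the following statements are equivalent: (i) $(ab)^{\dagger} = b^{\dagger}a^{\dagger}$; (ii) $(a^{\dagger})^{*}(pq^{\dagger}-q^{\dagger}p)b=0$ and $(a^{\dagger})^{*}(r^{\dagger}s-sr^{\dagger})b=0$; (iii) $spq^{\dagger}p = q^{\dagger}p$ and $sr^{\dagger}sp = sr^{\dagger}$.
   Context: An element $a$ of a $C^*$-algebra $A$ is called regular if there is $a'\in A$ with $a = aa'a$. Every regular element $a$ of a $C^*$-algebra has a unique Moore-Penrose inverse, denoted $a^{\dagger}$: the unique $x\in A$ with $a=axa$, $x=xax$, $(ax)^*=ax$, $(xa)^*=xa$. If $a$ and $b$ are regular, then $a^{\dagger}(a^{\dagger})^{*}$ and $bb^*$ are also regular, so $q^{\dagger}$ and $r^{\dagger}$ in the statement exist. *)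

theory Defs
  imports "HOL-Analysis.Analysis"
begin

text \<open>
  C*-algebras, not assumed to be unital (nor nonzero): complex Banach algebras with a conjugate-linear,
  antimultiplicative involution satisfying the C*-identity.  The library only knows real normed
  algebras, so the complex scalar multiplication is an additional operation, required to extend
  the real one.
\<close>

class cstar_algebra = real_normed_algebra + banach +
  fixes scaleC :: "complex \<Rightarrow> 'a \<Rightarrow> 'a"
    and star :: "'a \<Rightarrow> 'a"  ("(_\<^sup>\<star>)" [1000] 999)
  assumes scaleR_scaleC: "scaleR t x = scaleC (complex_of_real t) x"
    and scaleC_add_right: "scaleC c (x + y) = scaleC c x + scaleC c y"
    and scaleC_add_left: "scaleC (c + d) x = scaleC c x + scaleC d x"
    and scaleC_scaleC: "scaleC c (scaleC d x) = scaleC (c * d) x"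
    and mult_scaleC_left: "scaleC c x * y = scaleC c (x * y)"
    and mult_scaleC_right: "x * scaleC c y = scaleC c (x * y)"
    and norm_scaleC: "norm (scaleC c x) = cmod c * norm x"
    and star_add: "(x + y)\<^sup>\<star> = x\<^sup>\<star> + y\<^sup>\<star>"
    and star_scaleC: "(scaleC c x)\<^sup>\<star> = scaleC (cnj c) (x\<^sup>\<star>)"
    and star_mult: "(x * y)\<^sup>\<star> = y\<^sup>\<star> * x\<^sup>\<star>"
    and star_star: "(x\<^sup>\<star>)\<^sup>\<star> = x"
    and cstar_identity: "norm (x\<^sup>\<star> * x) = (norm x)\<^sup>2"

definition regular :: "'a::cstar_algebra \<Rightarrow> bool" where
  "regular a \<longleftrightarrow> (\<exists>a'. a = a * a' * a)"

definition is_mp_inverse :: "'a::cstar_algebra \<Rightarrow> 'a \<Rightarrow> bool" where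
  "is_mp_inverse a x \<longleftrightarrow>
     a = a * x * a \<and> x = x * a * x \<and> (a * x)\<^sup>\<star> = a * x \<and> (x * a)\<^sup>\<star> = x * a"

lemma is_mp_inverse_unique:
  assumes "is_mp_inverse a x" and "is_mp_inverse a y"
  shows "x = y"
proof -
  note mp = assms[unfolded is_mp_inverse_def]
  have "a * x = (a * y) * (a * x)"
    using mp by (metis mult.assoc)
  then have "(a * x)\<^sup>\<star> = (a * x)\<^sup>\<star> * (a * y)\<^sup>\<star>"
    by (metis star_mult)
  then have ax: "a * x = a * y"
    using mp by (metis mult.assoc)
  have "x * a = (x * a) * (y * a)"
    using mp by (metis mult.assoc)
  then have "(x * a)\<^sup>\<star> = (y * a)\<^sup>\<star> * (x * a)\<^sup>\<star>"
    by (metis star_mult)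
  then have xa: "x * a = y * a"
    using mp by (metis mult.assoc)
  show "x = y"
    using mp ax xa by (metis mult.assoc)
qed

text \<open>
  The description below is meaningful exactly when a Moore-Penrose inverse exists, which is the case
  for the regular elements; elsewhere its value is unspecified.
\<close>

definition mp_inverse :: "'a::cstar_algebra \<Rightarrow> 'a"  ("(_\<^sup>\<dagger>)" [1000] 999) where
  "a\<^sup>\<dagger> = (THE x. is_mp_inverse a x)"

end

theory Submission
  imports Defs
begin

text \<open>
  Write \<open>m = a * b\<close> and \<open>x = b\<^sup>\<dagger> * a\<^sup>\<dagger>\<close>.  The four Penrose equations for \<open>m\<close> and \<open>x\<close> collapse
  to two: \<open>(m * x)\<^sup>\<star> * m = m\<close> and \<open>(x * m)\<^sup>\<star> * x = x\<close>, because the first one, multiplied by \<open>x\<close>,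
  exhibits \<open>m * x\<close> in the form \<open>u\<^sup>\<star> * u\<close>, hence as self-adjoint, and the second one does the same for
  \<open>x * m\<close> (lemma \<open>is_mp_inverse_iff\<close>).

  On the other side, \<open>q\<^sup>\<dagger> = a\<^sup>\<star> * a\<close> and \<open>r\<^sup>\<dagger> = (b\<^sup>\<dagger>)\<^sup>\<star> * b\<^sup>\<dagger>\<close>.  Inserting these, the two
  equations of (ii) become precisely the two equations above, the second one after applying the
  involution.  The equations of (iii) are obtained
  from those of (ii) by multiplying with \<open>a\<^sup>\<star>\<close> on the left and \<open>b\<^sup>\<dagger>\<close> on the right; nothing is
  lost, since multiplying with \<open>(a\<^sup>\<dagger>)\<^sup>\<star>\<close> and \<open>b\<close> leads back.

  The analytic content lies in the existence of Moore-Penrose inverses of regular elements.  If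
  \<open>a = a * a' * a\<close>, then \<open>a * a'\<close> and \<open>a' * a\<close> are idempotents, and it is enough to replace them by
  self-adjoint idempotents with the same range and the same kernel, respectively.  The range
  projection \<open>f\<close> of an idempotent \<open>e\<close> has to satisfy \<open>f + (e\<^sup>\<star> - e) * f = e\<^sup>\<star>\<close>.  Here
  \<open>e\<^sup>\<star> - e\<close> is skew-adjoint, so its spectrum is imaginary and the equation is solvable; lemma
  \<open>skew_adjoint_solvable\<close> proves this by a contraction argument inside the possibly
  non-unital algebra.
\<close>

section \<open>The involution\<close>

lemma star_minus: "(- x)\<^sup>\<star> = - (x\<^sup>\<star>)" for x :: "'a::cstar_algebra"
proof -
  have "(0::'a)\<^sup>\<star> + 0\<^sup>\<star> = 0\<^sup>\<star>"
    using star_add[of "0::'a" 0] by simp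
  then have "(- x)\<^sup>\<star> + x\<^sup>\<star> = 0"
    using star_add[of "- x" x] by simp
  then show ?thesis
    by (simp add: eq_neg_iff_add_eq_0)
qed

lemma star_diff: "(x - y)\<^sup>\<star> = x\<^sup>\<star> - y\<^sup>\<star>" for x y :: "'a::cstar_algebra"
  using star_add[of x "- y"] by (simp add: star_minus)

lemma star_scaleR: "(t *\<^sub>R x)\<^sup>\<star> = t *\<^sub>R x\<^sup>\<star>" for x :: "'a::cstar_algebra"
  by (simp add: scaleR_scaleC star_scaleC)

lemma star_eq_iff: "x\<^sup>\<star> = y\<^sup>\<star> \<longleftrightarrow> x = y" for x y :: "'a::cstar_algebra"
  by (metis star_star)

lemma star_mult_self_eq_0: "x\<^sup>\<star> * x = 0 \<Longrightarrow> x = 0" for x :: "'a::cstar_algebra"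
  using cstar_identity[of x] by simp

section \<open>Moore-Penrose inverses of regular elements\<close>

text \<open>
  For real \<open>t\<close> the C*-identity bounds left multiplication by \<open>t - k\<close>: formally
  \<open>(t - k)\<^sup>\<star> * (t - k) = t\<^sup>2 - k\<^sup>2\<close>, of norm at most \<open>t\<^sup>2 + \<parallel>k\<parallel>\<^sup>2\<close>.
\<close>

lemma norm_skew_adjoint_shift_le:
  fixes k y :: "'a::cstar_algebra"
  assumes "k\<^sup>\<star> = - k"
  shows "(norm (t *\<^sub>R y - k * y))\<^sup>2 \<le> (t\<^sup>2 + (norm k)\<^sup>2) * (norm y)\<^sup>2"
proof -
  let ?u = "t *\<^sub>R y - k * y"
  have "?u\<^sup>\<star> * ?u = (t *\<^sub>R y\<^sup>\<star> + y\<^sup>\<star> * k) * ?u"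
    by (simp add: star_diff star_mult star_scaleR assms)
  also have "\<dots> = t\<^sup>2 *\<^sub>R (y\<^sup>\<star> * y) - y\<^sup>\<star> * k * (k * y)"
    by (simp add: algebra_simps power2_eq_square)
  also have "\<dots> = t\<^sup>2 *\<^sub>R (y\<^sup>\<star> * y) + (k * y)\<^sup>\<star> * (k * y)"
    by (simp add: star_mult assms)
  finally have "(norm ?u)\<^sup>2 = norm (t\<^sup>2 *\<^sub>R (y\<^sup>\<star> * y) + (k * y)\<^sup>\<star> * (k * y))"
    by (metis cstar_identity)
  also have "\<dots> \<le> norm (t\<^sup>2 *\<^sub>R (y\<^sup>\<star> * y)) + norm ((k * y)\<^sup>\<star> * (k * y))"
    by (rule norm_triangle_ineq)
  also have "\<dots> = t\<^sup>2 * (norm y)\<^sup>2 + (norm (k * y))\<^sup>2"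
    by (simp add: cstar_identity)
  also have "\<dots> \<le> t\<^sup>2 * (norm y)\<^sup>2 + (norm k * norm y)\<^sup>2"
    by (intro add_left_mono power_mono norm_mult_ineq norm_ge_zero)
  finally show ?thesis
    by (simp add: algebra_simps power_mult_distrib)
qed

text \<open>
  In the unitization, the element \<open>1 + k = (1 + t) - (t - k)\<close> is invertible.  Since
  \<open>\<parallel>t - k\<parallel>\<^sup>2 \<le> t\<^sup>2 + \<parallel>k\<parallel>\<^sup>2\<close> is smaller than \<open>(1 + t)\<^sup>2\<close> for large \<open>t\<close>, a Neumann series inverts
  it; as there need not be a unit, the series is replaced by the fixed point of a contraction.
\<close>

lemma skew_adjoint_solvable:
  fixes k z :: "'a::cstar_algebra"
  assumes "k\<^sup>\<star> = - k"
  obtains y where "y + k * y = z"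
proof -
  define t where "t = (norm k)\<^sup>2"
  define F where "F = (\<lambda>y. (1 / (1 + t)) *\<^sub>R (z + (t *\<^sub>R y - k * y)))"
  define C where "C = sqrt (t\<^sup>2 + t) / (1 + t)"
  have t: "t \<ge> 0"
    by (simp add: t_def)
  have "sqrt (t\<^sup>2 + t) < sqrt ((1 + t)\<^sup>2)"
    using t by (intro real_sqrt_less_mono) (simp add: power2_eq_square algebra_simps)
  then have C: "0 \<le> C" "C < 1"
    using t by (auto simp: C_def)
  have lip: "dist (F y) (F y') \<le> C * dist y y'" for y y'
  proof -
    have "norm (t *\<^sub>R (y - y') - k * (y - y')) \<le> sqrt ((t\<^sup>2 + t) * (norm (y - y'))\<^sup>2)"
      using norm_skew_adjoint_shift_le[OF assms, of t "y - y'"]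
      by (intro real_le_rsqrt) (simp add: t_def)
    also have "\<dots> = sqrt (t\<^sup>2 + t) * norm (y - y')"
      by (simp add: real_sqrt_mult)
    finally have le: "norm (t *\<^sub>R (y - y') - k * (y - y')) \<le> sqrt (t\<^sup>2 + t) * norm (y - y')" .
    have "F y - F y' = (1 / (1 + t)) *\<^sub>R (t *\<^sub>R (y - y') - k * (y - y'))"
      by (simp add: F_def algebra_simps)
    then have "norm (F y - F y') = norm (t *\<^sub>R (y - y') - k * (y - y')) / (1 + t)"
      using t by simp
    also have "\<dots> \<le> C * norm (y - y')"
      using divide_right_mono[OF le, of "1 + t"] t by (simp add: C_def)
    finally show ?thesis
      by (simp add: dist_norm)
  qed
  obtain y where "F y = y"
    using banach_fix_type[OF C, of F] lip by auto
  then have "(1 + t) *\<^sub>R y = (1 + t) *\<^sub>R F y"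
    by simp
  also have "\<dots> = z + (t *\<^sub>R y - k * y)"
    using t by (simp add: F_def)
  finally have "y + k * y = z"
    by (simp add: algebra_simps)
  then show thesis
    by (rule that)
qed

text \<open>
  A self-adjoint \<open>f\<close> with \<open>f * e = e\<close> and \<open>e * f = f\<close> also satisfies \<open>e\<^sup>\<star> * f = e\<^sup>\<star>\<close>, so it solves
  \<open>f + (e\<^sup>\<star> - e) * f = e\<^sup>\<star>\<close>.  Conversely, every solution has the required properties.
\<close>

lemma idempotent_range_projection:
  fixes e :: "'a::cstar_algebra"
  assumes e: "e * e = e"
  obtains f where "f\<^sup>\<star> = f" "f * e = e" "e * f = f"
proof -
  have "(e\<^sup>\<star> - e)\<^sup>\<star> = - (e\<^sup>\<star> - e)"
    by (simp add: star_diff star_star)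
  then obtain f where f: "f + (e\<^sup>\<star> - e) * f = e\<^sup>\<star>"
    by (rule skew_adjoint_solvable)
  let ?v = "e\<^sup>\<star> * f - e\<^sup>\<star>"
  have ee: "e * (e * z) = e * z" for z
    by (metis e mult.assoc)
  have "e * (f + (e\<^sup>\<star> - e) * f) = e * e\<^sup>\<star>"
    by (simp only: f)
  then have ev: "e * ?v = 0"
    by (simp add: algebra_simps ee)
  \<comment> \<open>The adjoint of \<open>?v\<close> ends in the factor \<open>e\<close>, which annihilates \<open>?v\<close>.\<close>
  have "?v\<^sup>\<star> * ?v = f\<^sup>\<star> * (e * ?v) - e * ?v"
    by (simp add: star_diff star_mult star_star left_diff_distrib mult.assoc)
  also have "\<dots> = 0"
    unfolding ev by simp
  finally have v: "e\<^sup>\<star> * f = e\<^sup>\<star>"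
    using star_mult_self_eq_0 by force
  have ef: "e * f = f"
    using f v by (simp add: algebra_simps)
  have fe: "f\<^sup>\<star> * e = e"
    using v by (metis star_mult star_star)
  have ff: "f\<^sup>\<star> * f = f"
    using ef fe by (metis mult.assoc)
  have "f\<^sup>\<star> = f"
    using ff by (metis star_mult star_star)
  then show thesis
    using that ef fe by simp
qed

text \<open>
  The projections \<open>f\<close> and \<open>h\<close> below are going to be \<open>a * a\<^sup>\<dagger>\<close> and \<open>a\<^sup>\<dagger> * a\<close>; compressing the
  given inner inverse by them makes it the Moore-Penrose inverse.
\<close>

lemma regular_imp_is_mp_inverse:
  fixes a :: "'a::cstar_algebra"
  assumes "regular a"
  shows "is_mp_inverse a (a\<^sup>\<dagger>)"
proof -
  obtain a' where a: "a * a' * a = a"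
    using assms unfolding regular_def by metis
  have "(a * a') * (a * a') = a * a'"
    using a by (metis mult.assoc)
  then obtain f where f: "f\<^sup>\<star> = f" "f * (a * a') = a * a'" "a * a' * f = f"
    by (rule idempotent_range_projection)
  have "(a' * a)\<^sup>\<star> * (a' * a)\<^sup>\<star> = (a' * a)\<^sup>\<star>"
    using a by (metis mult.assoc star_mult)
  then obtain h where h: "h\<^sup>\<star> = h" "h * (a' * a)\<^sup>\<star> = (a' * a)\<^sup>\<star>" "(a' * a)\<^sup>\<star> * h = h"
    by (rule idempotent_range_projection)
  have h': "a' * a * h = a' * a" "h * (a' * a) = h"
    using h by (metis star_mult star_star)+
  have hh: "h * h = h"
    using h' by (metis mult.assoc)
  let ?x = "h * a' * f"
  have "a * h = a"
    using a h' by (metis mult.assoc)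
  then have ax: "a * ?x = f"
    using f by (metis mult.assoc)
  have fa: "f * a = a"
    using a f by (metis mult.assoc)
  then have xa: "?x * a = h"
    using h' by (metis mult.assoc)
  have "is_mp_inverse a ?x"
    unfolding is_mp_inverse_def ax xa using f h fa hh by (simp add: mult.assoc[symmetric])
  then show ?thesis
    unfolding mp_inverse_def by (rule theI) (rule is_mp_inverse_unique[OF _ \<open>is_mp_inverse a ?x\<close>])
qed

section \<open>Calculating with Moore-Penrose inverses\<close>

lemma mp_inverse_eqI: "is_mp_inverse a x \<Longrightarrow> a\<^sup>\<dagger> = x"
  unfolding mp_inverse_def by (blast intro: is_mp_inverse_unique)

lemma mp_inverse_eq_iff: "regular a \<Longrightarrow> a\<^sup>\<dagger> = x \<longleftrightarrow> is_mp_inverse a x"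
  using regular_imp_is_mp_inverse mp_inverse_eqI by metis

lemma is_mp_inverse_commute: "is_mp_inverse a x \<longleftrightarrow> is_mp_inverse x a"
  by (auto simp: is_mp_inverse_def)

text \<open>
  Multiplying \<open>(a * x)\<^sup>\<star> * a = a\<close> by \<open>x\<close> on the right gives \<open>a * x = (a * x)\<^sup>\<star> * (a * x)\<close>, which
  is self-adjoint; hence also \<open>a * x * a = a\<close>.
\<close>

lemma is_mp_inverse_iff:
  "is_mp_inverse a x \<longleftrightarrow> (a * x)\<^sup>\<star> * a = a \<and> (x * a)\<^sup>\<star> * x = x"
proof
  assume "is_mp_inverse a x"
  then show "(a * x)\<^sup>\<star> * a = a \<and> (x * a)\<^sup>\<star> * x = x"
    by (simp add: is_mp_inverse_def)
next
  have self_adjoint: "(u * v)\<^sup>\<star> = u * v" if "(u * v)\<^sup>\<star> * u = u" for u v :: 'a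
  proof -
    have "(u * v)\<^sup>\<star> * (u * v) = u * v"
      using that by (metis mult.assoc)
    then show ?thesis
      by (metis star_mult star_star)
  qed
  assume "(a * x)\<^sup>\<star> * a = a \<and> (x * a)\<^sup>\<star> * x = x"
  then show "is_mp_inverse a x"
    using self_adjoint[of a x] self_adjoint[of x a] by (simp add: is_mp_inverse_def)
qed

lemma is_mp_inverse_star_rules:
  assumes "is_mp_inverse a x"
  shows "x\<^sup>\<star> * a\<^sup>\<star> = a * x" "a\<^sup>\<star> * x\<^sup>\<star> = x * a" "x\<^sup>\<star> * (x * a) = x\<^sup>\<star>" "a\<^sup>\<star> * (a * x) = a\<^sup>\<star>"
    "(a * x) * x\<^sup>\<star> = x\<^sup>\<star>" "(x * a) * a\<^sup>\<star> = a\<^sup>\<star>"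
  using assms unfolding is_mp_inverse_def by (metis mult.assoc star_mult)+

lemma is_mp_inverse_mult_star:
  assumes "is_mp_inverse a x"
  shows "is_mp_inverse (x * x\<^sup>\<star>) (a\<^sup>\<star> * a)"
proof -
  note rules = is_mp_inverse_star_rules[OF assms]
  have mp: "a * x * a = a" "x * a * x = x" "(x * a)\<^sup>\<star> = x * a"
    using assms by (auto simp: is_mp_inverse_def)
  have 1: "x * x\<^sup>\<star> * (a\<^sup>\<star> * a) = x * a"
    using rules mp by (metis mult.assoc)
  have 2: "a\<^sup>\<star> * a * (x * x\<^sup>\<star>) = x * a"
    using rules mp by (metis mult.assoc)
  have "x * a * (x * x\<^sup>\<star>) = x * x\<^sup>\<star>" "x * a * (a\<^sup>\<star> * a) = a\<^sup>\<star> * a"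
    using rules mp by (metis mult.assoc)+
  then show ?thesis
    unfolding is_mp_inverse_def 1 2 mp by simp
qed

section \<open>The reverse order law\<close>

theorem theorem3p4:
  fixes a b p q r s :: "'a::cstar_algebra"
  assumes "regular a" and "regular b" and "regular (a * b)"
    and "p = b * b\<^sup>\<dagger>"
    and "q = a\<^sup>\<dagger> * (a\<^sup>\<dagger>)\<^sup>\<star>"
    and "r = b * b\<^sup>\<star>"
    and "s = a\<^sup>\<dagger> * a"
  shows "((a * b)\<^sup>\<dagger> = b\<^sup>\<dagger> * a\<^sup>\<dagger>
          \<longleftrightarrow> (a\<^sup>\<dagger>)\<^sup>\<star> * (p * q\<^sup>\<dagger> - q\<^sup>\<dagger> * p) * b = 0
              \<and> (a\<^sup>\<dagger>)\<^sup>\<star> * (r\<^sup>\<dagger> * s - s * r\<^sup>\<dagger>) * b = 0)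
       \<and> ((a * b)\<^sup>\<dagger> = b\<^sup>\<dagger> * a\<^sup>\<dagger>
          \<longleftrightarrow> s * p * q\<^sup>\<dagger> * p = q\<^sup>\<dagger> * p
              \<and> s * r\<^sup>\<dagger> * s * p = s * r\<^sup>\<dagger>)"
proof -
  define c where "c = a\<^sup>\<dagger>"
  define d where "d = b\<^sup>\<dagger>"
  have ac: "is_mp_inverse a c" and bd: "is_mp_inverse b d"
    using assms(1,2) by (auto simp: c_def d_def regular_imp_is_mp_inverse)
  note A = is_mp_inverse_star_rules[OF ac] and B = is_mp_inverse_star_rules[OF bd]
  have mp: "a * c * a = a" "c * a * c = c" "b * d * b = b" "d * b * d = d"
    using ac bd by (auto simp: is_mp_inverse_def)
  have p: "p = b * d" and s: "s = c * a"
    using assms by (auto simp: c_def d_def)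
  have Q: "q\<^sup>\<dagger> = a\<^sup>\<star> * a"
    using mp_inverse_eqI[OF is_mp_inverse_mult_star[OF ac]] assms(5) by (simp add: c_def)
  have R: "r\<^sup>\<dagger> = d\<^sup>\<star> * d"
    using mp_inverse_eqI[OF is_mp_inverse_mult_star[of d b]] bd assms(6)
    by (simp add: is_mp_inverse_commute)
  have pb: "p * b = b" and pp: "p * p = p" and dp: "d * p = d" and cs: "c\<^sup>\<star> * s = c\<^sup>\<star>"
    and cQ: "c\<^sup>\<star> * q\<^sup>\<dagger> = a" and Rp: "r\<^sup>\<dagger> * p = r\<^sup>\<dagger>" and Rb: "r\<^sup>\<dagger> * b = d\<^sup>\<star>"
    and ac': "a\<^sup>\<star> * c\<^sup>\<star> = s"
    unfolding p s Q R using A B mp by (metis mult.assoc)+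
  let ?m = "a * b" and ?x = "d * c"
  have law: "(a * b)\<^sup>\<dagger> = d * c \<longleftrightarrow> (?m * ?x)\<^sup>\<star> * ?m = ?m \<and> (?x * ?m)\<^sup>\<star> * ?x = ?x"
    using assms(3) by (simp add: mp_inverse_eq_iff is_mp_inverse_iff)

  have mx: "(?m * ?x)\<^sup>\<star> * ?m = c\<^sup>\<star> * p * q\<^sup>\<dagger> * b"
    unfolding p Q using B by (metis star_mult mult.assoc)
  have m: "?m = c\<^sup>\<star> * q\<^sup>\<dagger> * p * b"
    using cQ pb by (metis mult.assoc)
  have first: "(?m * ?x)\<^sup>\<star> * ?m = ?m \<longleftrightarrow> c\<^sup>\<star> * (p * q\<^sup>\<dagger> - q\<^sup>\<dagger> * p) * b = 0"
    unfolding mx by (subst m) (simp add: algebra_simps)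

  \<comment> \<open>The second Penrose condition is compared after applying the involution.\<close>
  have xm: "((?x * ?m)\<^sup>\<star> * ?x)\<^sup>\<star> = c\<^sup>\<star> * r\<^sup>\<dagger> * s * b"
    unfolding R s by (simp add: star_mult star_star mult.assoc)
  have x: "?x\<^sup>\<star> = c\<^sup>\<star> * s * r\<^sup>\<dagger> * b"
    using cs Rb by (metis star_mult mult.assoc)
  have "(?x * ?m)\<^sup>\<star> * ?x = ?x \<longleftrightarrow> ((?x * ?m)\<^sup>\<star> * ?x)\<^sup>\<star> = ?x\<^sup>\<star>"
    by (simp only: star_eq_iff)
  then have second: "(?x * ?m)\<^sup>\<star> * ?x = ?x \<longleftrightarrow> c\<^sup>\<star> * (r\<^sup>\<dagger> * s - s * r\<^sup>\<dagger>) * b = 0"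
    unfolding xm x by (simp add: algebra_simps)

  \<comment> \<open>Multiplying (ii) with \<open>a\<^sup>\<star>\<close> and \<open>d\<close> produces the outer factors \<open>s = a\<^sup>\<star> * c\<^sup>\<star>\<close> and
    \<open>p = b * d\<close>, which \<open>q\<^sup>\<dagger>\<close> absorbs on the left and \<open>r\<^sup>\<dagger>\<close> on the right.  On the way back,
    \<open>c\<^sup>\<star>\<close> absorbs \<open>s\<close> and \<open>b\<close> absorbs \<open>p\<close>.\<close>
  have sQ: "s * q\<^sup>\<dagger> = q\<^sup>\<dagger>" and ss: "s * s = s"
    unfolding s Q using A mp by (metis mult.assoc)+
  have third: "c\<^sup>\<star> * (p * q\<^sup>\<dagger> - q\<^sup>\<dagger> * p) * b = 0 \<longleftrightarrow> s * p * q\<^sup>\<dagger> * p = q\<^sup>\<dagger> * p"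
  proof
    assume "c\<^sup>\<star> * (p * q\<^sup>\<dagger> - q\<^sup>\<dagger> * p) * b = 0"
    then have "a\<^sup>\<star> * (c\<^sup>\<star> * (p * q\<^sup>\<dagger> - q\<^sup>\<dagger> * p) * b) * d = 0"
      by simp
    then have "s * (p * q\<^sup>\<dagger> - q\<^sup>\<dagger> * p) * p = 0"
      unfolding ac'[symmetric] p by (simp only: mult.assoc)
    then have "s * p * q\<^sup>\<dagger> * p = (s * q\<^sup>\<dagger>) * (p * p)"
      by (simp add: algebra_simps)
    then show "s * p * q\<^sup>\<dagger> * p = q\<^sup>\<dagger> * p"
      by (simp only: sQ pp)
  next
    assume "s * p * q\<^sup>\<dagger> * p = q\<^sup>\<dagger> * p"
    then have "c\<^sup>\<star> * (s * p * q\<^sup>\<dagger> * p) * b = c\<^sup>\<star> * (q\<^sup>\<dagger> * p) * b"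
      by simp
    then have "(c\<^sup>\<star> * s) * p * q\<^sup>\<dagger> * (p * b) = c\<^sup>\<star> * q\<^sup>\<dagger> * p * b"
      by (simp only: mult.assoc)
    then show "c\<^sup>\<star> * (p * q\<^sup>\<dagger> - q\<^sup>\<dagger> * p) * b = 0"
      unfolding cs pb by (simp add: algebra_simps)
  qed
  have fourth: "c\<^sup>\<star> * (r\<^sup>\<dagger> * s - s * r\<^sup>\<dagger>) * b = 0 \<longleftrightarrow> s * r\<^sup>\<dagger> * s * p = s * r\<^sup>\<dagger>"
  proof
    assume "c\<^sup>\<star> * (r\<^sup>\<dagger> * s - s * r\<^sup>\<dagger>) * b = 0"
    then have "a\<^sup>\<star> * (c\<^sup>\<star> * (r\<^sup>\<dagger> * s - s * r\<^sup>\<dagger>) * b) * d = 0"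
      by simp
    then have "s * (r\<^sup>\<dagger> * s - s * r\<^sup>\<dagger>) * p = 0"
      unfolding ac'[symmetric] p by (simp only: mult.assoc)
    then have "s * r\<^sup>\<dagger> * s * p = (s * s) * (r\<^sup>\<dagger> * p)"
      by (simp add: algebra_simps)
    then show "s * r\<^sup>\<dagger> * s * p = s * r\<^sup>\<dagger>"
      by (simp only: ss Rp)
  next
    assume "s * r\<^sup>\<dagger> * s * p = s * r\<^sup>\<dagger>"
    then have "c\<^sup>\<star> * (s * r\<^sup>\<dagger> * s * p) * b = c\<^sup>\<star> * (s * r\<^sup>\<dagger>) * b"
      by simp
    then have "(c\<^sup>\<star> * s) * r\<^sup>\<dagger> * s * (p * b) = c\<^sup>\<star> * s * r\<^sup>\<dagger> * b"
      by (simp only: mult.assoc)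
    then show "c\<^sup>\<star> * (r\<^sup>\<dagger> * s - s * r\<^sup>\<dagger>) * b = 0"
      unfolding cs pb by (simp add: algebra_simps cs flip: mult.assoc)
  qed
  show ?thesis
    using law first second third fourth unfolding c_def d_def by blast
qed

end
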